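(* Let $\Sigma$ be a finite non-empty alphabet. The map ${}^\vee:\widetilde{\Sigma}^*\to\widetilde{\Sigma}^*$, $[(w_\varepsilon)]^\vee:=[(w_\varepsilon^\vee)]$, where $w^\vee$ denotes the reversal of the word $w$, is well defined (independent of the representative) and is an involutive anti-automorphism of the monoid $\widetilde{\Sigma}^*$: for all $x,y\in\widetilde{\Sigma}^*$, $(xy)^\vee=y^\vee x^\vee$, $(x^\vee)^\vee=x$, and $\mathbf{1}^\vee=\mathbf{1}$. Moreover $\iota(w^\vee)=\iota(w)^\vee$ for every finite word $w\in\Sigma^*$.
   Context: $\Sigma^*$ is the free monoid of finite words over $\Sigma$ under concatenation, $\lambda$ is the empty word, $|w|$ is the length of $w$. For $u\neq v$ in $\Sigma^*$, $\operatorname{lcp}(u,v)$ and $\operatorname{lcs}(u,v)$ are the lengths of the longest common prefix and of the longest common suffix of $u,v$; by convention $\operatorname{lcp}(u,u)=\operatorname{lcs}(u,u)=+\infty$. A net of words is a family $(w_\varepsilon)_{\varepsilon\in(0,1]}$ of words in $\Sigma^*$. It is moderate if there exist $N\in\mathbb{N}$, $C>0$, $\varepsilon_0>0$ with $|w_\varepsilon|\le C\varepsilon^{-N}$ for all $\varepsilon<\varepsilon_0$. $\mathcal{E}_M(\Sigma^* )$ is the set of moderate nets. Two moderate nets are equivalent, $(u_\varepsilon)\sim(v_\varepsilon)$, if for every $m\in\mathbb{N}$ there exists $\varepsilon_0>0$ such that $\min\{\operatorname{lcp}(u_\varepsilon,v_\varepsilon),\operatorname{lcs}(u_\varepsilon,v_\varepsilon)\}\ge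 m\log_2(1/\varepsilon)$ for all $\varepsilon<\varepsilon_0$; this is an equivalence relation. $\widetilde{\Sigma}^*:=\mathcal{E}_M(\Sigma^* )/\sim$ is a monoid under the well-defined product $[(u_\varepsilon)]\cdot[(v_\varepsilon)]:=[(u_\varepsilon v_\varepsilon)]$, with identity $\mathbf{1}=[(\lambda)_\varepsilon]$. For $w\in\Sigma^*$, $\iota(w)\in\widetilde{\Sigma}^*$ is the class of the constant net equal to $w$. *)

theory Defs
  imports Complex_Main "HOL-Library.Sublist" "HOL-Library.Extended_Real"
begin

section \<open>Common prefixes and suffixes of words\<close>

definition lcp :: "'a list \<Rightarrow> 'a list \<Rightarrow> ereal" where
  "lcp u v = (if u = v then \<infinity> else ereal (real (length (longest_common_prefix u v))))"

definition lcs :: "'a list \<Rightarrow> 'a list \<Rightarrow> ereal" where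
  "lcs u v = (if u = v then \<infinity> else ereal (real (Max {length s |s. suffix s u \<and> suffix s v})))"

lemma le_lcp_iff:
  "ereal r \<le> lcp u v \<longleftrightarrow> u = v \<or> (\<exists>p. prefix p u \<and> prefix p v \<and> r \<le> real (length p))"
proof (cases "u = v")
  case False
  have "r \<le> real (length (longest_common_prefix u v))"
    if "prefix p u" "prefix p v" "r \<le> real (length p)" for p
    using longest_common_prefix_max_prefix[OF that(1,2)] that(3)
    by (meson of_nat_mono order_trans prefix_length_le)
  with False show ?thesis
    by (auto simp: lcp_def intro: longest_common_prefix_prefix1 longest_common_prefix_prefix2)
qed (simp add: lcp_def)

lemma le_lcs_iff:
  "ereal r \<le> lcs u v \<longleftrightarrow> u = v \<or> (\<exists>s. suffix s u \<and> suffix s v \<and> r \<le> real (length s))"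
proof (cases "u = v")
  case False
  let ?L = "{length s |s. suffix s u \<and> suffix s v}"
  have fin: "finite ?L"
    by (rule finite_subset[of _ "{..length u}"]) (auto dest: suffix_length_le)
  have "?L \<noteq> {}"
    using suffix_bot.bot_least by blast
  with fin have "Max ?L \<in> ?L"
    by (rule Max_in)
  moreover have "length s \<le> Max ?L" if "suffix s u" "suffix s v" for s
    using fin that by (intro Max_ge) auto
  ultimately show ?thesis
    using False by (auto simp: lcs_def) (meson of_nat_mono order_trans)
qed (simp add: lcs_def)

lemma lcp_commute: "lcp u v = lcp v u"
  by (induction u v rule: longest_common_prefix.induct) (auto simp: lcp_def)

lemma lcs_commute: "lcs u v = lcs v u"
  by (simp add: lcs_def conj_commute)

lemma le_lcp_trans:
  assumes "ereal r \<le> lcp u v" "ereal r \<le> lcp v w"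
  shows "ereal r \<le> lcp u w"
proof (cases "u = v \<or> v = w")
  case False
  with assms obtain p q
    where p: "prefix p u" "prefix p v" "r \<le> real (length p)"
      and q: "prefix q v" "prefix q w" "r \<le> real (length q)"
    by (auto simp: le_lcp_iff)
  from p(2) q(1) consider "prefix p q" | "prefix q p"
    using prefix_same_cases by blast
  then show ?thesis
  proof cases
    case 1
    from this q(2) have "prefix p w"
      by (rule prefix_order.trans)
    with p(1,3) show ?thesis
      unfolding le_lcp_iff by blast
  next
    case 2
    then have "prefix q u"
      using p(1) by (rule prefix_order.trans)
    with q(2,3) show ?thesis
      unfolding le_lcp_iff by blast
  qed
qed (use assms in auto)

lemma le_lcs_trans:
  assumes "ereal r \<le> lcs u v" "ereal r \<le> lcs v w"
  shows "ereal r \<le> lcs u w"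
proof (cases "u = v \<or> v = w")
  case False
  with assms obtain p q
    where p: "suffix p u" "suffix p v" "r \<le> real (length p)"
      and q: "suffix q v" "suffix q w" "r \<le> real (length q)"
    by (auto simp: le_lcs_iff)
  from p(2) q(1) consider "suffix p q" | "suffix q p"
    using suffix_same_cases by blast
  then show ?thesis
  proof cases
    case 1
    from this q(2) have "suffix p w"
      by (rule suffix_order.trans)
    with p(1,3) show ?thesis
      unfolding le_lcs_iff by blast
  next
    case 2
    then have "suffix q u"
      using p(1) by (rule suffix_order.trans)
    with q(2,3) show ?thesis
      unfolding le_lcs_iff by blast
  qed
qed (use assms in auto)

lemma le_lcp_append:
  assumes "ereal r \<le> lcp u u'" "ereal r \<le> lcp v v'"
  shows "ereal r \<le> lcp (u @ v) (u' @ v')"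
proof (rule le_lcp_trans)
  show "ereal r \<le> lcp (u @ v) (u' @ v)"
    using assms(1) unfolding le_lcp_iff by (metis prefix_prefix)
  show "ereal r \<le> lcp (u' @ v) (u' @ v')"
  proof (cases "v = v'")
    case False
    then obtain p where "prefix p v" "prefix p v'" "r \<le> real (length p)"
      using assms(2) by (auto simp: le_lcp_iff)
    then show ?thesis
      unfolding le_lcp_iff by (intro disjI2 exI[of _ "u' @ p"]) auto
  qed (simp add: lcp_def)
qed

lemma le_lcs_append:
  assumes "ereal r \<le> lcs u u'" "ereal r \<le> lcs v v'"
  shows "ereal r \<le> lcs (u @ v) (u' @ v')"
proof (rule le_lcs_trans)
  show "ereal r \<le> lcs (u @ v) (u @ v')"
    using assms(2) unfolding le_lcs_iff by (metis suffix_appendI)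
  show "ereal r \<le> lcs (u @ v') (u' @ v')"
  proof (cases "u = u'")
    case False
    then obtain s where "suffix s u" "suffix s u'" "r \<le> real (length s)"
      using assms(1) by (auto simp: le_lcs_iff)
    then show ?thesis
      unfolding le_lcs_iff by (intro disjI2 exI[of _ "s @ v'"]) auto
  qed (simp add: lcs_def)
qed


section \<open>Nets of words\<close>

typedef unit_param = "{0<..1::real}" morphisms eps Abs_unit_param
  by (rule exI[of _ 1]) simp

type_synonym 'a net = "unit_param \<Rightarrow> 'a list"

definition moderate :: "'a net \<Rightarrow> bool" where
  "moderate w \<longleftrightarrow> (\<exists>(N::nat) (C::real) (\<epsilon>\<^sub>0::real). C > 0 \<and> \<epsilon>\<^sub>0 > 0 \<and>
     (\<forall>i. eps i < \<epsilon>\<^sub>0 \<longrightarrow> real (length (w i)) \<le> C * eps i powr (- real N)))"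

definition net_equiv :: "'a net \<Rightarrow> 'a net \<Rightarrow> bool" where
  "net_equiv u v \<longleftrightarrow> (\<forall>m::nat. \<exists>\<epsilon>\<^sub>0>0. \<forall>i. eps i < \<epsilon>\<^sub>0 \<longrightarrow>
     min (lcp (u i) (v i)) (lcs (u i) (v i)) \<ge> ereal (real m * log 2 (1 / eps i)))"

definition moderate_equiv :: "'a net \<Rightarrow> 'a net \<Rightarrow> bool" where
  "moderate_equiv u v \<longleftrightarrow> moderate u \<and> moderate v \<and> net_equiv u v"

definition net_rev :: "'a net \<Rightarrow> 'a net" where
  "net_rev w = (\<lambda>i. rev (w i))"

lemma moderate_const: "moderate (\<lambda>_. w)"
proof -
  have "eps i \<noteq> 0" for i
    using eps[of i] by auto
  then show ?thesis
    unfolding moderate_def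
    by (intro exI[of _ 0] exI[of _ "real (length w) + 1"] exI[of _ 1]) auto
qed

lemma moderate_append:
  assumes "moderate u" "moderate v"
  shows "moderate (\<lambda>i. u i @ v i)"
proof -
  obtain N C e where u: "C > 0" "e > 0"
      "\<And>i. eps i < e \<Longrightarrow> real (length (u i)) \<le> C * eps i powr (- real N)"
    using assms(1) unfolding moderate_def by blast
  obtain M D d where v: "D > 0" "d > 0"
      "\<And>i. eps i < d \<Longrightarrow> real (length (v i)) \<le> D * eps i powr (- real M)"
    using assms(2) unfolding moderate_def by blast
  have "real (length (u i @ v i)) \<le> (C + D) * eps i powr (- real (N + M))"
    if i: "eps i < min e d" for i
  proof -
    have e: "0 < eps i" "eps i \<le> 1"
      using eps[of i] by auto
    have "eps i powr (- real N) \<le> eps i powr (- real (N + M))"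
         "eps i powr (- real M) \<le> eps i powr (- real (N + M))"
      using e by (auto intro!: powr_mono')
    then have "C * eps i powr (- real N) + D * eps i powr (- real M)
        \<le> C * eps i powr (- real (N + M)) + D * eps i powr (- real (N + M))"
      using u(1) v(1) by (intro add_mono mult_left_mono) auto
    with u(3)[of i] v(3)[of i] i show ?thesis
      by (simp add: algebra_simps)
  qed
  then show ?thesis
    unfolding moderate_def using u(1,2) v(1,2)
    by (intro exI[of _ "N + M"] exI[of _ "C + D"] exI[of _ "min e d"]) auto
qed

lemma net_equiv_refl: "net_equiv u u"
  unfolding net_equiv_def lcp_def lcs_def by (intro allI exI[of _ 1]) simp

lemma net_equiv_sym: "net_equiv u v \<Longrightarrow> net_equiv v u"
  by (simp add: net_equiv_def lcp_commute lcs_commute)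

lemma net_equiv_combine:
  assumes "net_equiv u u'" "net_equiv v v'"
    and "\<And>i r. ereal r \<le> lcp (u i) (u' i) \<Longrightarrow> ereal r \<le> lcp (v i) (v' i) \<Longrightarrow>
           ereal r \<le> lcp (w i) (w' i)"
    and "\<And>i r. ereal r \<le> lcs (u i) (u' i) \<Longrightarrow> ereal r \<le> lcs (v i) (v' i) \<Longrightarrow>
           ereal r \<le> lcs (w i) (w' i)"
  shows "net_equiv w w'"
  unfolding net_equiv_def
proof
  fix m :: nat
  obtain e where e: "e > 0" "\<And>i. eps i < e \<Longrightarrow>
      min (lcp (u i) (u' i)) (lcs (u i) (u' i)) \<ge> ereal (real m * log 2 (1 / eps i))"
    using assms(1) unfolding net_equiv_def by blast
  obtain d where d: "d > 0" "\<And>i. eps i < d \<Longrightarrow>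
      min (lcp (v i) (v' i)) (lcs (v i) (v' i)) \<ge> ereal (real m * log 2 (1 / eps i))"
    using assms(2) unfolding net_equiv_def by blast
  show "\<exists>\<epsilon>\<^sub>0>0. \<forall>i. eps i < \<epsilon>\<^sub>0 \<longrightarrow>
      min (lcp (w i) (w' i)) (lcs (w i) (w' i)) \<ge> ereal (real m * log 2 (1 / eps i))"
  proof (intro exI[of _ "min e d"] conjI allI impI)
    fix i assume "eps i < min e d"
    with e(2)[of i] d(2)[of i] assms(3,4)
    show "min (lcp (w i) (w' i)) (lcs (w i) (w' i)) \<ge> ereal (real m * log 2 (1 / eps i))"
      by simp
  qed (use e(1) d(1) in simp)
qed

lemma net_equiv_trans: "net_equiv u v \<Longrightarrow> net_equiv v w \<Longrightarrow> net_equiv u w"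
  by (rule net_equiv_combine[of u v v w])
     (assumption | erule (1) le_lcp_trans le_lcs_trans)+

lemma net_equiv_append:
  "net_equiv u u' \<Longrightarrow> net_equiv v v' \<Longrightarrow> net_equiv (\<lambda>i. u i @ v i) (\<lambda>i. u' i @ v' i)"
  by (rule net_equiv_combine[of u u' v v']) 
     (assumption | erule (1) le_lcp_append le_lcs_append)+


section \<open>The monoid of generalized words\<close>

quotient_type 'a gword = "'a net" / partial: moderate_equiv
proof (rule part_equivpI)
  show "\<exists>u. moderate_equiv u u"
    unfolding moderate_equiv_def using moderate_const net_equiv_refl by blast
  show "symp moderate_equiv"
    by (rule sympI) (simp add: moderate_equiv_def net_equiv_sym)
  show "transp moderate_equiv"
    unfolding moderate_equiv_def by (rule transpI) (meson net_equiv_trans)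
qed

text \<open>The class of a net; it is meaningful for moderate nets only.\<close>

abbreviation gword_class :: "'a net \<Rightarrow> 'a gword" where
  "gword_class \<equiv> abs_gword"

lemma gword_class_eq_iff:
  "moderate u \<Longrightarrow> moderate v \<Longrightarrow> gword_class u = gword_class v \<longleftrightarrow> net_equiv u v"
  using Quotient_rel[OF Quotient_gword, of u v]
  by (simp add: moderate_equiv_def net_equiv_refl)

instantiation gword :: (type) monoid_mult
begin

lift_definition one_gword :: "'a gword" is "\<lambda>_. []"
  by (simp add: moderate_equiv_def moderate_const net_equiv_refl)

lift_definition times_gword :: "'a gword \<Rightarrow> 'a gword \<Rightarrow> 'a gword" is "\<lambda>u v i. u i @ v i"
  by (simp add: moderate_equiv_def moderate_append net_equiv_append)

instance
  by standard (transfer; simp add: moderate_equiv_def moderate_append net_equiv_refl)+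

end

lift_definition iota :: "'a list \<Rightarrow> 'a gword" is "\<lambda>w _. w"
  by (simp add: moderate_equiv_def moderate_const net_equiv_refl)

text \<open>Reversal is defined through the representative chosen by \<^const>\<open>rep_gword\<close>, so that
  independence of the representative is a property to be proved rather than a precondition of
  the definition.\<close>

definition gword_rev :: "'a gword \<Rightarrow> 'a gword" where
  "gword_rev x = gword_class (net_rev (rep_gword x))"

end

theory Submission
  imports Defs
begin

text \<open>Reversing two words exchanges their common prefixes with their common suffixes and keeps
  lengths. So reversal exchanges \<^const>\<open>lcp\<close> and \<^const>\<open>lcs\<close>; since equivalence of nets
  bounds the minimum of the two, reversing two nets does not affect whether they are equivalent
  (\<open>net_equiv_net_rev_iff\<close>). Moderateness depends on lengths only. Hence reversal descends to
  classes (\<open>gword_rev_class\<close>): it may be computed on any moderate representative. As every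
  generalized word is the class of a moderate net, the algebraic laws are then inherited from
  the corresponding laws of \<^const>\<open>rev\<close>, and an involution is bijective.\<close>

text \<open>A word is a suffix of two words exactly if its reversal is a prefix of their reversals.\<close>

lemma le_lcp_rev_iff: "ereal r \<le> lcp (rev u) (rev v) \<longleftrightarrow> ereal r \<le> lcs u v"
proof -
  have "(\<exists>p. prefix p (rev u) \<and> prefix p (rev v) \<and> r \<le> real (length p)) \<longleftrightarrow>
        (\<exists>s. suffix s u \<and> suffix s v \<and> r \<le> real (length s))"
    unfolding suffix_to_prefix by (metis length_rev rev_rev_ident)
  then show ?thesis
    by (simp add: le_lcp_iff le_lcs_iff)
qed

lemma le_lcs_rev_iff: "ereal r \<le> lcs (rev u) (rev v) \<longleftrightarrow> ereal r \<le> lcp u v"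
  using le_lcp_rev_iff[of r "rev u" "rev v"] by simp

lemma net_rev_net_rev [simp]: "net_rev (net_rev u) = u"
  by (simp add: net_rev_def)

lemma moderate_net_rev_iff [simp]: "moderate (net_rev u) \<longleftrightarrow> moderate u"
  by (simp add: moderate_def net_rev_def)

lemma net_equiv_net_rev_iff [simp]: "net_equiv (net_rev u) (net_rev v) \<longleftrightarrow> net_equiv u v"
  by (simp add: net_equiv_def net_rev_def le_lcp_rev_iff le_lcs_rev_iff conj_commute)

lemma gword_class_cases:
  obtains u where "moderate u" "x = gword_class u"
  by (induction x rule: gword.abs_induct) (auto simp: moderate_equiv_def)

text \<open>The chosen representative \<open>rep_gword (gword_class u)\<close> need not be \<open>u\<close>, but it is
  moderate and equivalent to \<open>u\<close>; its reversal is then equivalent to that of \<open>u\<close>.\<close>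

lemma gword_rev_class:
  assumes "moderate u"
  shows "gword_rev (gword_class u) = gword_class (net_rev u)"
proof -
  have "moderate_equiv (rep_gword (gword_class u)) u"
    using assms by (intro rep_abs_rsp_left[OF Quotient3_gword])
      (simp add: moderate_equiv_def net_equiv_refl)
  then show ?thesis
    by (simp add: gword_rev_def gword_class_eq_iff moderate_equiv_def)
qed

lemma times_gword_class:
  "moderate u \<Longrightarrow> moderate v \<Longrightarrow> gword_class u * gword_class v = gword_class (\<lambda>i. u i @ v i)"
  by (simp add: times_gword.abs_eq moderate_equiv_def net_equiv_refl)

lemma gword_rev_times: "gword_rev (x * y) = gword_rev y * gword_rev x"
proof -
  obtain u where u: "moderate u" "x = gword_class u"
    by (rule gword_class_cases)
  obtain v where v: "moderate v" "y = gword_class v"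
    by (rule gword_class_cases)
  have "net_rev (\<lambda>i. u i @ v i) = (\<lambda>i. net_rev v i @ net_rev u i)"
    by (simp add: net_rev_def)
  then show ?thesis
    using u v by (simp add: times_gword_class gword_rev_class moderate_append)
qed

lemma gword_rev_gword_rev: "gword_rev (gword_rev x) = x"
  by (cases x rule: gword_class_cases) (simp add: gword_rev_class)

lemma gword_rev_iota: "gword_rev (iota w) = iota (rev w)"
  by (simp add: iota.abs_eq gword_rev_class moderate_const) (simp add: net_rev_def)

lemma gword_rev_one: "gword_rev 1 = 1"
  by (simp add: one_gword_def gword_rev_class moderate_const) (simp add: net_rev_def)

theorem mainTheorem11:
  shows
    "(\<forall>u :: 'a::finite net. moderate u \<longrightarrow> moderate (net_rev u)) \<and>
     (\<forall>u v :: 'a net. moderate u \<longrightarrow> moderate v \<longrightarrow> net_equiv u v \<longrightarrow>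
        net_equiv (net_rev u) (net_rev v)) \<and>
     (\<forall>u :: 'a net. moderate u \<longrightarrow> gword_rev (gword_class u) = gword_class (net_rev u)) \<and>
     bij (gword_rev :: 'a gword \<Rightarrow> 'a gword) \<and>
     (\<forall>x y :: 'a gword. gword_rev (x * y) = gword_rev y * gword_rev x) \<and>
     (\<forall>x :: 'a gword. gword_rev (gword_rev x) = x) \<and>
     gword_rev (1 :: 'a gword) = 1 \<and>
     (\<forall>w :: 'a list. iota (rev w) = gword_rev (iota w))"
  using involuntory_imp_bij[of "gword_rev :: 'a gword \<Rightarrow> 'a gword", OF gword_rev_gword_rev]
  by (simp add: gword_rev_class gword_rev_times gword_rev_gword_rev gword_rev_one gword_rev_iota)

end
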